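(* Let $U:\mathbb{R}^+\to\mathbb{R}^+$ be a measurable function. If $U\in\textit{O-RV}$ and the limit $$\lim_{x\to\infty}\frac{\log(U(x))}{\log(x)}$$ exists, then $U\in\mathcal{M}$.
   Context: $\mathbb{R}^+=(0,\infty)$; functions $U:\mathbb{R}^+\to\mathbb{R}^+$ are thus strictly positive. $\log$ is the natural logarithm. $\textit{O-RV}$ (the class of $O$-regularly varying functions) is the class of measurable functions $U:\mathbb{R}^+\to\mathbb{R}^+$ such that for all $t\ge1$, $$0<\liminf_{x\to\infty}\frac{U(tx)}{U(x)}\le\limsup_{x\to\infty}\frac{U(tx)}{U(x)}<\infty.$$ $\mathcal{M}$ is the class of measurable functions $U:\mathbb{R}^+\to\mathbb{R}^+$ for which there exists $\rho\in\mathbb{R}$ such that for all $\epsilon>0$, $\lim_{x\to\infty}U(x)/x^{\rho+\epsilon}=0$ and $\lim_{x\to\infty}U(x)/x^{\rho-\epsilon}=\infty$. *)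

theory Defs
  imports "HOL-Analysis.Analysis"
begin

text \<open>
  A function from the open half-line to itself is represented by a total function on the reals;
  its values at nonpositive arguments are irrelevant to every notion below.
  Measurability is Lebesgue measurability.
\<close>

definition pos_measurable :: "(real \<Rightarrow> real) set" where
  "pos_measurable = {U. U \<in> borel_measurable (lebesgue_on {0<..}) \<and> (\<forall>x>0. U x > 0)}"

text \<open>The limits inferior and superior are taken in the extended reals, where they always exist.\<close>

definition O_RV :: "(real \<Rightarrow> real) set" where
  "O_RV = {U \<in> pos_measurable. \<forall>t\<ge>1.
     0 < Liminf at_top (\<lambda>x. ereal (U (t * x) / U x)) \<and>
     Liminf at_top (\<lambda>x. ereal (U (t * x) / U x)) \<le> Limsup at_top (\<lambda>x. ereal (U (t * x) / U x)) \<and>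
     Limsup at_top (\<lambda>x. ereal (U (t * x) / U x)) < \<infinity>}"

definition class_M :: "(real \<Rightarrow> real) set" where
  "class_M = {U \<in> pos_measurable. \<exists>\<rho>::real. \<forall>\<epsilon>>0.
     ((\<lambda>x. U x / x powr (\<rho> + \<epsilon>)) \<longlongrightarrow> 0) at_top \<and>
     filterlim (\<lambda>x. U x / x powr (\<rho> - \<epsilon>)) at_top at_top}"

end

theory Submission
  imports Defs "HOL-Real_Asymp.Real_Asymp"
begin

text \<open>
  If the logarithmic ratio $\log U(x) / \log x$ has a \<^emph>\<open>finite\<close> limit $\rho$, then $U(x)$ is
  $x^{\rho + o(1)}$, which is membership in the class with index $\rho$
  (\<open>powr_asymptotics_of_log_ratio\<close>). The limit is taken in the extended reals, so the
  question is why it cannot be infinite, and this is where \<open>O\<close>-regular variation enters,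
  through the single dilation factor $t = 2$:
  eventually $\log U(2x)$ differs from $\log U(x)$ by at most a constant $K$. Iterating along
  $x_n = 2^n x_0$, the quantity $\log U(x_n)$ grows at most linearly in $n$, while $\log x_n$ grows
  at least like $n \log 2$. The ratio is therefore bounded along a sequence tending to infinity
  (\<open>log_ratio_bounded_along_geometric\<close>), and the limit, which exists by
  hypothesis and must agree with the limit along this sequence, is finite.
\<close>

text \<open>
  The extended-real bounds on the limits inferior and superior are replaced by one real bound on an
  additive increment, the form that can be iterated.
\<close>

lemma O_RV_log_increment_bounded:
  assumes "U \<in> O_RV" "t \<ge> 1"
  shows "\<exists>K. \<forall>\<^sub>F x in at_top. \<bar>ln (U (t * x)) - ln (U x)\<bar> \<le> K"
proof -
  let ?q = "\<lambda>x. U (t * x) / U x"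
  have pos: "U x > 0" if "x > 0" for x
    using assms(1) that by (auto simp: O_RV_def pos_measurable_def)
  obtain c where c: "0 < ereal c" "ereal c < Liminf at_top (\<lambda>x. ereal (?q x))"
    using assms ereal_dense2[of 0 "Liminf at_top (\<lambda>x. ereal (?q x))"] by (auto simp: O_RV_def)
  obtain C where C: "Limsup at_top (\<lambda>x. ereal (?q x)) < ereal C"
    using assms ereal_dense2[of "Limsup at_top (\<lambda>x. ereal (?q x))" \<infinity>] by (auto simp: O_RV_def)
  have "\<forall>\<^sub>F x in at_top. c < ?q x" "\<forall>\<^sub>F x in at_top. ?q x < C"
    using less_LiminfD[OF c(2)] Limsup_lessD[OF C] by simp_all
  then have "\<forall>\<^sub>F x in at_top. \<bar>ln (U (t * x)) - ln (U x)\<bar> \<le> max \<bar>ln c\<bar> \<bar>ln C\<bar>"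
    using eventually_gt_at_top[of 0]
  proof eventually_elim
    case (elim x)
    have U: "U x > 0" "U (t * x) > 0"
      using elim assms(2) by (auto intro!: pos)
    have "ln c \<le> ln (?q x)" "ln (?q x) \<le> ln C"
      using elim c(1) U by (auto intro!: ln_mono)
    then show ?case
      using U by (auto simp: ln_div)
  qed
  then show ?thesis by blast
qed

lemma log_ratio_bounded_along_geometric:
  fixes U :: "real \<Rightarrow> real"
  assumes t: "t > 1"
    and K: "\<forall>\<^sub>F x in at_top. \<bar>ln (U (t * x)) - ln (U x)\<bar> \<le> K"
  obtains x :: "nat \<Rightarrow> real" and B
  where "filterlim x at_top sequentially" "\<forall>\<^sub>F n in sequentially. \<bar>ln (U (x n)) / ln (x n)\<bar> \<le> B"
proof -
  \<comment> \<open>Starting at or beyond 1 makes \<open>ln x\<^sub>0 \<ge> 0\<close>, so that \<open>ln (t ^ n * x\<^sub>0) \<ge> n * ln t\<close>.\<close>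
  obtain x0 where x0: "x0 \<ge> 1" "\<And>x. x \<ge> x0 \<Longrightarrow> \<bar>ln (U (t * x)) - ln (U x)\<bar> \<le> K"
    using eventually_conj[OF K eventually_ge_at_top[of 1]]
    unfolding eventually_at_top_linorder by (metis order.refl)
  define x where "x = (\<lambda>n::nat. t ^ n * x0)"
  define A where "A = \<bar>ln (U x0)\<bar>"
  have ge: "x n \<ge> x0" for n
    using x0(1) t by (simp add: x_def)
  have num: "\<bar>ln (U (x n))\<bar> \<le> A + n * K" for n
  proof (induction n)
    case 0
    show ?case by (simp add: x_def A_def)
  next
    case (Suc n)
    have "x (Suc n) = t * x n" by (simp add: x_def)
    then have "\<bar>ln (U (x (Suc n))) - ln (U (x n))\<bar> \<le> K"
      using x0(2)[OF ge] by simp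
    then show ?case
      using Suc by (simp add: algebra_simps)
  qed
  have den: "ln (x n) \<ge> n * ln t" for n
    using x0(1) t by (simp add: x_def ln_mult ln_realpow)
  have bound: "\<bar>ln (U (x n)) / ln (x n)\<bar> \<le> (A + K) / ln t" if n: "n \<ge> 1" for n
  proof -
    have lt: "n * ln t > 0"
      using n t by simp
    have "A \<le> n * A"
      using n by (simp add: A_def mult_le_cancel_right1)
    then have num': "\<bar>ln (U (x n))\<bar> \<le> n * (A + K)"
      using num[of n] by (simp add: algebra_simps)
    have "\<bar>ln (U (x n)) / ln (x n)\<bar> = \<bar>ln (U (x n))\<bar> / ln (x n)"
      using lt den[of n] by (simp add: abs_divide)
    also have "\<dots> \<le> (n * (A + K)) / (n * ln t)"
      using num' den[of n] lt by (intro frac_le) auto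
    finally show ?thesis
      using n by simp
  qed
  have "filterlim x at_top sequentially"
    unfolding x_def using x0(1) t by real_asymp
  moreover have "\<forall>\<^sub>F n in sequentially. \<bar>ln (U (x n)) / ln (x n)\<bar> \<le> (A + K) / ln t"
    using bound by (auto simp: eventually_sequentially)
  ultimately show ?thesis by (rule that)
qed

text \<open>
  Writing $U(x) = x^{r(x)}$ with $r(x) \to \rho$, half of \<open>\<epsilon>\<close> absorbs the error $r(x) - \rho$ and the
  other half leaves a factor $x^{\pm\epsilon/2}$ that forces the limit.
\<close>

lemma powr_asymptotics_of_log_ratio:
  fixes U :: "real \<Rightarrow> real"
  assumes pos: "\<And>x. x > 0 \<Longrightarrow> U x > 0"
    and lim: "((\<lambda>x. ln (U x) / ln x) \<longlongrightarrow> \<rho>) at_top"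
    and \<epsilon>: "\<epsilon> > 0"
  shows "((\<lambda>x. U x / x powr (\<rho> + \<epsilon>)) \<longlongrightarrow> 0) at_top"
    and "filterlim (\<lambda>x. U x / x powr (\<rho> - \<epsilon>)) at_top at_top"
proof -
  have U_eq: "U x = x powr (ln (U x) / ln x)" if "x > 1" for x
    using that pos[of x] by (simp add: powr_def)
  have close: "\<forall>\<^sub>F x in at_top. dist (ln (U x) / ln x) \<rho> < \<epsilon> / 2"
    using lim \<epsilon> by (intro tendstoD) auto
  have upper: "\<forall>\<^sub>F x in at_top. U x / x powr (\<rho> + \<epsilon>) \<le> x powr (- (\<epsilon> / 2))"
    using close eventually_gt_at_top[of 1]
  proof eventually_elim
    case (elim x)
    have "U x / x powr (\<rho> + \<epsilon>) = x powr (ln (U x) / ln x - (\<rho> + \<epsilon>))"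
      by (simp only: powr_diff U_eq[OF elim(2), symmetric])
    also have "\<dots> \<le> x powr (- (\<epsilon> / 2))"
      using elim unfolding dist_real_def by (intro powr_mono) linarith+
    finally show ?case .
  qed
  have lower: "\<forall>\<^sub>F x in at_top. x powr (\<epsilon> / 2) \<le> U x / x powr (\<rho> - \<epsilon>)"
    using close eventually_gt_at_top[of 1]
  proof eventually_elim
    case (elim x)
    have "x powr (\<epsilon> / 2) \<le> x powr (ln (U x) / ln x - (\<rho> - \<epsilon>))"
      using elim unfolding dist_real_def by (intro powr_mono) linarith+
    also have "\<dots> = U x / x powr (\<rho> - \<epsilon>)"
      by (simp only: powr_diff U_eq[OF elim(2), symmetric])
    finally show ?case .
  qed
  have nonneg: "\<forall>\<^sub>F x in at_top. 0 \<le> U x / x powr (\<rho> + \<epsilon>)"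
    using eventually_gt_at_top[of 0] by eventually_elim (simp add: pos less_imp_le)
  have "((\<lambda>x::real. x powr (- (\<epsilon> / 2))) \<longlongrightarrow> 0) at_top"
    using \<epsilon> by real_asymp
  then show "((\<lambda>x. U x / x powr (\<rho> + \<epsilon>)) \<longlongrightarrow> 0) at_top"
    by (rule tendsto_sandwich[OF nonneg upper tendsto_const])
  have "filterlim (\<lambda>x::real. x powr (\<epsilon> / 2)) at_top at_top"
    using \<epsilon> by real_asymp
  then show "filterlim (\<lambda>x. U x / x powr (\<rho> - \<epsilon>)) at_top at_top"
    using lower by (rule filterlim_at_top_mono)
qed

theorem proposition4:
  fixes U :: "real \<Rightarrow> real"
  assumes "U \<in> pos_measurable"
    and "U \<in> O_RV"
    and "\<exists>L::ereal. ((\<lambda>x. ereal (ln (U x) / ln x)) \<longlongrightarrow> L) at_top"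
  shows "U \<in> class_M"
proof -
  obtain L :: ereal where L: "((\<lambda>x. ereal (ln (U x) / ln x)) \<longlongrightarrow> L) at_top"
    using assms(3) by blast
  obtain K where "\<forall>\<^sub>F x in at_top. \<bar>ln (U (2 * x)) - ln (U x)\<bar> \<le> K"
    using O_RV_log_increment_bounded[OF assms(2), of 2] by auto
  then obtain x :: "nat \<Rightarrow> real" and B where x: "filterlim x at_top sequentially"
    and B: "\<forall>\<^sub>F n in sequentially. \<bar>ln (U (x n)) / ln (x n)\<bar> \<le> B"
    using log_ratio_bounded_along_geometric[of 2 U K] by auto
  have seq: "(\<lambda>n. ereal (ln (U (x n)) / ln (x n))) \<longlonglongrightarrow> L"
    by (rule filterlim_compose[OF L x])
  have "L \<le> ereal B"
    by (rule tendsto_upperbound[OF seq]) (use B in \<open>auto simp del: abs_divide simp: abs_le_iff elim: eventually_mono\<close>)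
  moreover have "ereal (- B) \<le> L"
    by (rule tendsto_lowerbound[OF seq]) (use B in \<open>auto simp del: abs_divide simp: abs_le_iff elim: eventually_mono\<close>)
  ultimately obtain \<rho> where "L = ereal \<rho>"
    by (cases L) auto
  then have "((\<lambda>x. ln (U x) / ln x) \<longlongrightarrow> \<rho>) at_top"
    using L by simp
  moreover have "\<And>x. x > 0 \<Longrightarrow> U x > 0"
    using assms(1) by (simp add: pos_measurable_def)
  ultimately show ?thesis
    using assms(1) powr_asymptotics_of_log_ratio[of U \<rho>] unfolding class_M_def by blast
qed

end
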